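(* Let $m,n\ge 1$ be integers, let $p_1,\dots,p_m>0$ with $\sum_{i=1}^m p_i=1$, and let $Y=(Y_1,\dots,Y_n)$ be a vector of i.i.d. random variables with $P(Y_j=i)=p_i$ for all $i\in[m]$ and $j\in[n]$. Let $\mathcal N_n$ be the empirical nerve of $Y$. Then the probability that $\mathcal N_n$ is the $(m-1)$-simplex $\Delta_{m-1}$ (equivalently, that its graph is the complete graph $K_m$ on all $m$ labels) satisfies $$P(\mathcal N_n=\Delta_{m-1})\ \ge\ \left(\sum_{x\in\mathcal X_m^{\lfloor n/2\rfloor}}M(x)\right)^2,$$ where $\mathcal X_m^{\lfloor n/2\rfloor}=\{(x_1,\dots,x_m)\in\mathbb N^m:\sum_{i=1}^m x_i=\lfloor n/2\rfloor\}$, with $\mathbb N=\{1,2,3,\dots\}$, and $M(x)=\frac{(x_1+\cdots+x_m)!}{x_1!\cdots x_m!}\prod_{i=1}^m p_i^{x_i}$. In the uniform case where $p_i=\frac1m$ for every $i\in[m]$, this gives $$P(\mathcal N_n=\Delta_{m-1})\ \ge\ \left(\frac{m!}{m^{\lfloor n/2\rfloor}}\,S_{\lfloor n/2\rfloor}^{m}\right)^2,$$ where $S_N^k$ denotes the Stirling number of the second kind (the number of partitions of an $N$-element set into $k$ nonempty blocks).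
   Context: Notation: $[N]=\{1,\dots,N\}$. For each label $i\in[m]$, the empirical support is $I_n(i)=\mathrm{Conv}(\{j\in[n]:Y_j=i\})\subset\mathbb R$, i.e. the closed interval from the first to the last index at which label $i$ occurs (possibly a single point; empty if label $i$ does not occur). The empirical nerve $\mathcal N_n$ is the abstract simplicial complex whose simplices are the nonempty subsets $J\subseteq[m]$ with $\bigcap_{i\in J}I_n(i)\ne\emptyset$; its 1-skeleton (its graph) has as vertices the labels $i$ with $I_n(i)\neq\emptyset$, with $\{i,j\}$, $i\ne j$, an edge iff $I_n(i)\cap I_n(j)\neq\emptyset$. $\Delta_{m-1}$ is the full simplex on vertex set $[m]$, i.e. $\mathcal N_n=\Delta_{m-1}$ means $\bigcap_{i=1}^m I_n(i)\neq\emptyset$. An empty sum is $0$. *)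

theory Defs
  imports "HOL-Probability.Probability" "HOL-Combinatorics.Stirling"
begin

definition empirical_support :: "nat \<Rightarrow> (nat \<Rightarrow> nat) \<Rightarrow> nat \<Rightarrow> real set" where
  "empirical_support n y i = convex hull (real ` {j \<in> {1..n}. y j = i})"

text \<open>An abstract simplicial complex is represented by the set of its (nonempty) simplices.\<close>

definition empirical_nerve :: "nat \<Rightarrow> nat \<Rightarrow> (nat \<Rightarrow> nat) \<Rightarrow> nat set set" where
  "empirical_nerve m n y =
     {J. J \<noteq> {} \<and> J \<subseteq> {1..m} \<and> (\<Inter>i\<in>J. empirical_support n y i) \<noteq> {}}"

definition full_simplex :: "nat \<Rightarrow> nat set set" where
  "full_simplex m = {J. J \<noteq> {} \<and> J \<subseteq> {1..m}}"

text \<open>A simple graph is represented by its vertex set and its set of two-element edges.\<close>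

definition one_skeleton :: "'a set set \<Rightarrow> 'a set \<times> 'a set set" where
  "one_skeleton K = ({v. {v} \<in> K}, {e \<in> K. card e = 2})"

definition complete_graph_on :: "nat \<Rightarrow> nat set \<times> nat set set" where
  "complete_graph_on m = ({1..m}, {e. e \<subseteq> {1..m} \<and> card e = 2})"

lemma one_skeleton_empirical_nerve:
  "one_skeleton (empirical_nerve m n y) =
     ({i \<in> {1..m}. empirical_support n y i \<noteq> {}},
      {{i, j} |i j. i \<in> {1..m} \<and> j \<in> {1..m} \<and> i \<noteq> j \<and>
                    empirical_support n y i \<inter> empirical_support n y j \<noteq> {}})"
proof -
  have edge: "e \<in> empirical_nerve m n y \<and> card e = 2 \<longleftrightarrow>
      (\<exists>i j. e = {i, j} \<and> i \<in> {1..m} \<and> j \<in> {1..m} \<and> i \<noteq> j \<and>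
             empirical_support n y i \<inter> empirical_support n y j \<noteq> {})" for e
  proof -
    have "{i, j} \<in> empirical_nerve m n y \<longleftrightarrow> i \<in> {1..m} \<and> j \<in> {1..m} \<and>
        empirical_support n y i \<inter> empirical_support n y j \<noteq> {}" for i j
      by (simp add: empirical_nerve_def)
    then show ?thesis
      unfolding card_2_iff by blast
  qed
  show ?thesis
    unfolding one_skeleton_def edge by (auto simp: empirical_nerve_def)
qed

text \<open>The vectors with \<open>m\<close> positive integer entries and total \<open>N\<close>; they are extensional
  functions on \<open>{1..m}\<close>, so that each vector is represented exactly once.\<close>

definition compositions :: "nat \<Rightarrow> nat \<Rightarrow> (nat \<Rightarrow> nat) set" where
  "compositions m N = {x \<in> {1..m} \<rightarrow>\<^sub>E {1..}. (\<Sum>i=1..m. x i) = N}"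

definition multinomial_prob :: "nat \<Rightarrow> (nat \<Rightarrow> real) \<Rightarrow> (nat \<Rightarrow> nat) \<Rightarrow> real" where
  "multinomial_prob m p x =
     fact (\<Sum>i=1..m. x i) / (\<Prod>i=1..m. fact (x i)) * (\<Prod>i=1..m. p i ^ x i)"

end

theory Submission
  imports Defs "HOL-Combinatorics.Multiset_Permutations"
begin

text \<open>
  If every label occurs both among \<open>Y\<^sub>1, \<dots>, Y\<^sub>h\<close> and among \<open>Y\<^sub>h\<^sub>+\<^sub>1, \<dots>, Y\<^sub>2\<^sub>h\<close>, where
  \<open>h = \<lfloor>n/2\<rfloor>\<close>, then every empirical support contains \<open>h + 1/2\<close> and the nerve is the full simplex.
  The two halves are independent, and each is a word of length \<open>h\<close> using all labels; grouping
  these words by their numbers of occurrences of the labels gives the multinomial sum, and in the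
  uniform case there are \<open>m!\<close> times a Stirling number of them. That the graph of the nerve
  determines whether it is full is the one-dimensional Helly theorem.
\<close>

section \<open>Words that use every letter of an alphabet, and their number\<close>

definition full_words :: "'a set \<Rightarrow> nat \<Rightarrow> 'a list set" where
  "full_words A N = {xs. length xs = N \<and> set xs = A}"

lemma finite_full_words:
  assumes "finite A"
  shows "finite (full_words A N)"
  by (rule finite_subset[OF _ finite_lists_length_eq[OF assms, of N]]) (auto simp: full_words_def)

text \<open>Split off the first letter \<open>a\<close>: the rest of the word either still uses all
  of \<open>A\<close> or misses exactly \<open>a\<close>.\<close>

lemma full_words_Suc:
  "full_words A (Suc N) = (\<Union>a\<in>A. Cons a ` (full_words A N \<union> full_words (A - {a}) N))"
proof (intro equalityI subsetI)
  fix xs assume "xs \<in> full_words A (Suc N)"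
  then obtain y ys where "xs = y # ys" "length ys = N" "insert y (set ys) = A"
    by (auto simp: full_words_def length_Suc_conv)
  then show "xs \<in> (\<Union>a\<in>A. Cons a ` (full_words A N \<union> full_words (A - {a}) N))"
    by (cases "y \<in> set ys") (auto simp: full_words_def image_iff insert_absorb)
next
  fix xs assume "xs \<in> (\<Union>a\<in>A. Cons a ` (full_words A N \<union> full_words (A - {a}) N))"
  then obtain a ys where "xs = a # ys" "a \<in> A" "ys \<in> full_words A N \<union> full_words (A - {a}) N"
    by blast
  then show "xs \<in> full_words A (Suc N)"
    by (auto simp: full_words_def insert_absorb)
qed

text \<open>Such words are the surjections from \<open>N\<close> positions onto \<open>A\<close>.
  With \<open>k = card A\<close>, splitting off the first letter gives the recurrence
  \<open>S(N+1,k) = k S(N,k) + S(N,k-1)\<close> multiplied by \<open>k!\<close>.\<close>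

lemma card_full_words:
  assumes "finite A"
  shows "card (full_words A N) = fact (card A) * Stirling N (card A)"
  using assms
proof (induction N arbitrary: A)
  case 0
  have "full_words A 0 = (if A = {} then {[]} else {})"
    by (auto simp: full_words_def)
  then show ?case
    using 0 by (cases "card A") auto
next
  case (Suc N)
  have disj: "full_words A N \<inter> full_words (A - {a}) N = {}" if "a \<in> A" for a
    using that by (auto simp: full_words_def)
  have "card (full_words A (Suc N)) =
      (\<Sum>a\<in>A. card (Cons a ` (full_words A N \<union> full_words (A - {a}) N)))"
    unfolding full_words_Suc
  proof (rule card_UN_disjoint)
    show "\<forall>a\<in>A. finite (Cons a ` (full_words A N \<union> full_words (A - {a}) N))"
      using Suc.prems by (simp add: finite_full_words)
  qed (use Suc.prems in blast)+
  also have "\<dots> = (\<Sum>a\<in>A. card (full_words A N) + card (full_words (A - {a}) N))"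
    using disj Suc.prems
    by (intro sum.cong) (simp_all add: card_image card_Un_disjoint finite_full_words)
  also have "\<dots> = (\<Sum>a\<in>A. fact (card A) * Stirling N (card A)
      + fact (card A - 1) * Stirling N (card A - 1))"
    by (rule sum.cong) (use Suc in auto)
  also have "\<dots> = fact (card A) * Stirling (Suc N) (card A)"
    by (cases "card A") (use Suc.prems in \<open>auto simp: algebra_simps\<close>)
  finally show ?case .
qed

section \<open>The multinomial sum as a sum over words\<close>

lemma finite_compositions: "finite (compositions m N)"
proof (rule finite_subset)
  show "compositions m N \<subseteq> {1..m} \<rightarrow>\<^sub>E {..N}"
    by (auto simp: compositions_def PiE_def Pi_iff intro!: member_le_sum)
qed (auto intro: finite_PiE)

text \<open>These words are the arrangements of the multiset \<open>B\<close> that holds each letter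
  \<open>a\<close> exactly \<open>x a\<close> times, so their number is a multinomial coefficient.
  The product form avoids division of natural numbers.\<close>

lemma card_lists_with_counts:
  fixes x :: "'a \<Rightarrow> nat"
  assumes "finite A" and "\<And>a. a \<in> A \<Longrightarrow> x a > 0"
  defines "W \<equiv> {xs. set xs = A \<and> (\<forall>a\<in>A. count_list xs a = x a)}"
  shows "card W * (\<Prod>a\<in>A. fact (x a)) = fact (\<Sum>a\<in>A. x a)"
proof -
  define B where "B = (\<Sum>a\<in>A. replicate_mset (x a) a)"
  have count: "count B a = (if a \<in> A then x a else 0)" for a
    using assms(1) by (simp add: B_def count_sum)
  \<comment> \<open>Positivity of \<open>x\<close> puts every letter of \<open>A\<close> into
    \<open>B\<close>.\<close>
  have set: "set_mset B = A"
    using assms(2) by (auto simp: set_eq_iff count simp flip: count_greater_zero_iff)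
  have "W = permutations_of_multiset B"
  proof (intro equalityI subsetI)
    fix xs assume "xs \<in> W"
    then show "xs \<in> permutations_of_multiset B"
      by (auto simp: W_def permutations_of_multiset_def multiset_eq_iff count count_mset)
  next
    fix xs assume "xs \<in> permutations_of_multiset B"
    then have *: "mset xs = B"
      by (simp add: permutations_of_multiset_def)
    then have "set xs = A"
      using set set_mset_mset by metis
    then show "xs \<in> W"
      using * by (auto simp: W_def count simp flip: count_mset)
  qed
  moreover have "size B = (\<Sum>a\<in>A. x a)"
    by (simp add: B_def)
  ultimately show ?thesis
    using card_permutations_of_multiset_aux[of B] by (simp add: set count)
qed

lemma prod_list_map_eq_prod_count:
  fixes f :: "'a \<Rightarrow> 'b::comm_monoid_mult"
  shows "prod_list (map f xs) = (\<Prod>a\<in>set xs. f a ^ count_list xs a)"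
proof -
  have "prod_list (map f xs) = prod_mset (image_mset f (mset xs))"
    by (simp only: prod_mset_prod_list flip: mset_map)
  then show ?thesis
    by (simp add: image_prod_mset_multiplicity count_mset)
qed

text \<open>Group the words by their vector of letter counts. All words over the same
  \<open>x\<close> have the same weight, and the multinomial coefficient counts them.\<close>

lemma sum_multinomial_prob:
  "(\<Sum>x\<in>compositions m N. multinomial_prob m p x) =
    (\<Sum>xs\<in>full_words {1..m} N. prod_list (map p xs))"
proof -
  \<comment> \<open>The restriction makes the count vector extensional, like the members of
    \<open>compositions\<close>.\<close>
  define g where "g xs = restrict (count_list xs) {1..m}" for xs :: "nat list"
  have g: "g ` full_words {1..m} N \<subseteq> compositions m N"
    by (auto simp: g_def full_words_def compositions_def PiE_iff Suc_le_eq count_list_0_iff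
        sum_count_set simp flip: neq0_conv)
  have fib: "(\<Sum>xs | xs \<in> full_words {1..m} N \<and> g xs = x. prod_list (map p xs)) =
      multinomial_prob m p x" if x: "x \<in> compositions m N" for x
  proof -
    have pos: "x i > 0" if "i \<in> {1..m}" for i
      using x that by (auto simp: compositions_def PiE_iff Suc_le_eq)
    have N: "(\<Sum>i=1..m. x i) = N"
      using x by (auto simp: compositions_def)
    have g_eq: "g xs = x \<longleftrightarrow> (\<forall>i\<in>{1..m}. count_list xs i = x i)" for xs
      using x by (auto simp: g_def compositions_def PiE_iff extensional_def fun_eq_iff)
    \<comment> \<open>The counts already determine the length, so the fibre of \<open>g\<close> is
      exactly the set counted by \<open>card_lists_with_counts\<close>.\<close>
    have "length xs = N" if "set xs = {1..m}" "\<forall>i\<in>{1..m}. count_list xs i = x i" for xs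
      using that N sum_count_set[of xs "{1..m}"] by simp
    then have W: "{xs \<in> full_words {1..m} N. g xs = x} =
        {xs. set xs = {1..m} \<and> (\<forall>i\<in>{1..m}. count_list xs i = x i)}" (is "?F = ?W")
      by (auto simp: g_eq full_words_def)
    have "real (card ?W) * (\<Prod>i=1..m. fact (x i)) = fact (\<Sum>i=1..m. x i)"
      using arg_cong[OF card_lists_with_counts[of "{1..m}" x], of real] pos by simp
    then have "real (card ?W) = fact (\<Sum>i=1..m. x i) / (\<Prod>i=1..m. fact (x i))"
      by (simp add: eq_divide_eq)
    moreover have "(\<Sum>xs\<in>?F. prod_list (map p xs)) = real (card ?W) * (\<Prod>i=1..m. p i ^ x i)"
      unfolding W by (simp add: prod_list_map_eq_prod_count)
    ultimately show ?thesis
      by (simp add: multinomial_prob_def)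
  qed
  have "(\<Sum>xs\<in>full_words {1..m} N. prod_list (map p xs)) =
      (\<Sum>x\<in>compositions m N. \<Sum>xs | xs \<in> full_words {1..m} N \<and> g xs = x. prod_list (map p xs))"
    by (rule sum.group[symmetric]) (auto simp: finite_compositions finite_full_words g[THEN subsetD])
  also have "\<dots> = (\<Sum>x\<in>compositions m N. multinomial_prob m p x)"
    by (rule sum.cong[OF refl fib])
  finally show ?thesis ..
qed

section \<open>Full nerves, complete graphs and Helly's theorem on the line\<close>

lemma empirical_nerve_eq_full_simplex_iff:
  assumes "m \<ge> 1"
  shows "empirical_nerve m n y = full_simplex m \<longleftrightarrow>
    (\<Inter>i\<in>{1..m}. empirical_support n y i) \<noteq> {}"
proof
  \<comment> \<open>Since \<open>m >= 1\<close>, the set of all labels is nonempty and hence itself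
    a simplex.\<close>
  have "{1..m} \<in> full_simplex m"
    using assms by (auto simp: full_simplex_def)
  moreover assume "empirical_nerve m n y = full_simplex m"
  ultimately show "(\<Inter>i\<in>{1..m}. empirical_support n y i) \<noteq> {}"
    unfolding empirical_nerve_def by blast
next
  assume "(\<Inter>i\<in>{1..m}. empirical_support n y i) \<noteq> {}"
  then obtain t where "t \<in> empirical_support n y i" if "i \<in> {1..m}" for i
    by blast
  then have "t \<in> (\<Inter>i\<in>J. empirical_support n y i)" if "J \<subseteq> {1..m}" for J
    using that by blast
  then show "empirical_nerve m n y = full_simplex m"
    unfolding empirical_nerve_def full_simplex_def by blast
qed

lemma helly_real:
  fixes F :: "real set set"
  assumes "finite F" and "\<And>S. S \<in> F \<Longrightarrow> convex S"
    and pair: "\<And>S T. S \<in> F \<Longrightarrow> T \<in> F \<Longrightarrow> S \<inter> T \<noteq> {}"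
  shows "\<Inter>F \<noteq> {}"
\<comment> \<open>Helly's theorem in dimension 1 concerns families of at least two sets. A family
  with one member is settled by \<open>pair\<close> with \<open>S = T\<close>, and the empty family
  has intersection \<open>UNIV\<close>.\<close>
proof (cases "card F \<ge> 2")
  case True
  show ?thesis
  proof (rule Helly)
    fix t assume "t \<subseteq> F" "card t = DIM(real) + 1"
    then show "\<Inter>t \<noteq> {}"
      using pair by (auto simp: card_2_iff numeral_2_eq_2[symmetric])
  qed (use True assms in auto)
next
  case False
  then have "card F = 0 \<or> card F = 1"
    by linarith
  then show ?thesis
    using assms(1) pair by (auto simp: card_1_singleton_iff)
qed

lemma full_simplex_iff_complete_graph:
  assumes "m \<ge> 1"
  shows "empirical_nerve m n y = full_simplex m \<longleftrightarrow>
    one_skeleton (empirical_nerve m n y) = complete_graph_on m"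
proof
  assume "empirical_nerve m n y = full_simplex m"
  then show "one_skeleton (empirical_nerve m n y) = complete_graph_on m"
    unfolding one_skeleton_def complete_graph_on_def full_simplex_def by force
next
  assume graph: "one_skeleton (empirical_nerve m n y) = complete_graph_on m"
  have "empirical_support n y i \<inter> empirical_support n y j \<noteq> {}"
    if ij: "i \<in> {1..m}" "j \<in> {1..m}" for i j
  proof -
    have "{i, j} \<in> empirical_nerve m n y"
    \<comment> \<open>The diagonal case comes from the vertex set of the graph, which says that each
      support is nonempty; the other cases come from its edges.\<close>
    proof (cases "i = j")
      case True
      then show ?thesis
        using graph ij by (auto simp: one_skeleton_def complete_graph_on_def)
    next
      case False
      then have "{i, j} \<in> snd (complete_graph_on m)"
        using ij by (auto simp: complete_graph_on_def)
      then show ?thesis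
        by (auto simp: one_skeleton_def simp flip: graph)
    qed
    then show ?thesis
      by (simp add: empirical_nerve_def)
  qed
  then have "\<Inter>(empirical_support n y ` {1..m}) \<noteq> {}"
    by (intro helly_real) (auto simp: empirical_support_def)
  then show "empirical_nerve m n y = full_simplex m"
    using assms by (simp add: empirical_nerve_eq_full_simplex_iff)
qed

lemma empirical_nerve_full:
  assumes "m \<ge> 1" and "2 * h \<le> n"
    and "{1..m} \<subseteq> y ` {1..h}" and "{1..m} \<subseteq> y ` {h<..2*h}"
  shows "empirical_nerve m n y = full_simplex m"
proof -
  have "real h + 1/2 \<in> empirical_support n y i" if i: "i \<in> {1..m}" for i
  proof -
    obtain j k where j: "j \<in> {1..h}" "y j = i" and k: "k \<in> {h<..2*h}" "y k = i"
      using assms(3,4)[THEN subsetD, OF i] by auto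
    \<comment> \<open>The support is a convex hull, so it contains the segment between an occurrence
      of \<open>i\<close> in each half; \<open>j <= h\<close> and \<open>h + 1 <= k\<close> place
      \<open>h + 1/2\<close> on it.\<close>
    have "closed_segment (real j) (real k) \<subseteq> empirical_support n y i"
      unfolding empirical_support_def
      using j k assms(2) by (intro closed_segment_subset convex_convex_hull hull_inc imageI) auto
    moreover have "real h + 1/2 \<in> closed_segment (real j) (real k)"
      using j k by (auto simp: closed_segment_eq_real_ivl)
    ultimately show ?thesis
      by blast
  qed
  then show ?thesis
    unfolding empirical_nerve_eq_full_simplex_iff[OF assms(1)] by blast
qed

section \<open>Finite words of random labels: measurability and probability\<close>

lemma empirical_nerve_cong:
  assumes "\<And>j. j \<in> {1..n} \<Longrightarrow> y j = z j"
  shows "empirical_nerve m n y = empirical_nerve m n z"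
proof -
  have "{j \<in> {1..n}. y j = i} = {j \<in> {1..n}. z j = i}" for i
    using assms by auto
  then show ?thesis
    unfolding empirical_nerve_def empirical_support_def by simp
qed

text \<open>Labels are indexed from 1 and list entries from 0, hence the shift \<open>j - 1\<close>.
  An equality of words thus becomes one condition per label.\<close>

lemma map_upt_eq_iff:
  "map f [1..<Suc N] = zs \<longleftrightarrow> length zs = N \<and> (\<forall>j\<in>{1..N}. f j = zs ! (j - 1))"
proof -
  have "map f [1..<Suc N] = zs \<longleftrightarrow> length zs = N \<and> (\<forall>i<N. f (Suc i) = zs ! i)"
    by (auto simp: list_eq_iff_nth_eq simp del: upt_Suc)
  also have "(\<forall>i<N. f (Suc i) = zs ! i) \<longleftrightarrow> (\<forall>j\<in>{1..N}. f j = zs ! (j - 1))"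
  proof safe
    fix j assume "\<forall>i<N. f (Suc i) = zs ! i" "j \<in> {1..N}"
    then show "f j = zs ! (j - 1)"
      by (cases j) auto
  next
    fix i assume *: "\<forall>j\<in>{1..N}. f j = zs ! (j - 1)" and "i < N"
    then show "f (Suc i) = zs ! i"
      using bspec[OF *, of "Suc i"] by simp
  qed
  finally show ?thesis .
qed

text \<open>Lists over a countable type form a countable type, so preimages of singletons suffice.
  Each is given by finitely many conditions on single labels, or is empty if the length is
  wrong.\<close>

lemma word_measurable:
  fixes Y :: "nat \<Rightarrow> 'w \<Rightarrow> 'a::countable"
  assumes Y: "\<And>j. j \<in> {1..N} \<Longrightarrow> Y j \<in> measurable M (count_space UNIV)"
  shows "(\<lambda>\<omega>. map (\<lambda>j. Y j \<omega>) [1..<Suc N]) \<in> measurable M (count_space UNIV)"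
  unfolding measurable_count_space_eq2_countable
proof (intro conjI ballI)
  fix zs :: "'a list"
  have "(\<lambda>\<omega>. map (\<lambda>j. Y j \<omega>) [1..<Suc N]) -` {zs} \<inter> space M =
      {\<omega>\<in>space M. map (\<lambda>j. Y j \<omega>) [1..<Suc N] = zs}"
    by blast
  also have "\<dots> = (if length zs = N then {\<omega>\<in>space M. \<forall>j\<in>{1..N}. Y j \<omega> = zs ! (j - 1)} else {})"
    unfolding map_upt_eq_iff by auto
  finally have "(\<lambda>\<omega>. map (\<lambda>j. Y j \<omega>) [1..<Suc N]) -` {zs} \<inter> space M = \<dots>" .
  moreover have "{\<omega>\<in>space M. \<forall>j\<in>{1..N}. Y j \<omega> = zs ! (j - 1)} \<in> sets M"
  proof (rule sets.sets_Collect_finite_All)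
    fix j assume "j \<in> {1..N}"
    from measurable_sets[OF Y[OF this], of "{zs ! (j - 1)}"]
    show "{\<omega> \<in> space M. Y j \<omega> = zs ! (j - 1)} \<in> sets M"
      by (simp add: vimage_def Int_def conj_commute)
  qed simp
  ultimately show "(\<lambda>\<omega>. map (\<lambda>j. Y j \<omega>) [1..<Suc N]) -` {zs} \<inter> space M \<in> sets M"
    by simp
qed simp

text \<open>Only the letters of \<open>zs\<close> need a prescribed probability, because in the
  application \<open>p\<close> is tied to the labels in \<open>{1..m}\<close> alone.\<close>

lemma (in prob_space) prob_word:
  fixes Y :: "nat \<Rightarrow> 'a \<Rightarrow> 'b::countable"
  assumes indep: "indep_vars (\<lambda>_. count_space UNIV) Y {1..n}" and "N \<le> n" and len: "length zs = N"
    and p: "\<And>j a. j \<in> {1..n} \<Longrightarrow> a \<in> set zs \<Longrightarrow> prob {\<omega> \<in> space M. Y j \<omega> = a} = p a"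
  shows "prob {\<omega> \<in> space M. map (\<lambda>j. Y j \<omega>) [1..<Suc N] = zs} = prod_list (map p zs)"
\<comment> \<open>The empty word is treated apart: an intersection over no positions would be
  \<open>UNIV\<close> instead of \<open>space M\<close>.\<close>
proof (cases "N = 0")
  case True
  then show ?thesis
    using len by (simp add: prob_space)
next
  case False
  have "{\<omega> \<in> space M. map (\<lambda>j. Y j \<omega>) [1..<Suc N] = zs} =
      (\<Inter>j\<in>{1..N}. Y j -` {zs ! (j - 1)} \<inter> space M)"
    using False len unfolding map_upt_eq_iff by auto
  also have "prob \<dots> = (\<Prod>j=1..N. prob (Y j -` {zs ! (j - 1)} \<inter> space M))"
    by (rule indep_varsD[OF indep]) (use False \<open>N \<le> n\<close> in auto)
  also have "\<dots> = (\<Prod>j=1..N. p (zs ! (j - 1)))"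
  proof (rule prod.cong)
    fix j assume j: "j \<in> {1..N}"
    have "Y j -` {zs ! (j - 1)} \<inter> space M = {\<omega> \<in> space M. Y j \<omega> = zs ! (j - 1)}"
      by auto
    then show "prob (Y j -` {zs ! (j - 1)} \<inter> space M) = p (zs ! (j - 1))"
      using p[of j "zs ! (j - 1)"] j \<open>N \<le> n\<close> len by auto
  qed simp
  also have "\<dots> = (\<Prod>i<N. p (zs ! i))"
    by (rule prod.reindex_bij_witness[of _ Suc "\<lambda>j. j - 1"]) auto
  also have "\<dots> = prod_list (map p zs)"
    by (simp add: prod.list_conv_set_nth len lessThan_atLeast0)
  finally show ?thesis .
qed

section \<open>The lower bound from pairs of words on the two halves\<close>

lemma (in prob_space) prob_full_simplex_ge:
  fixes Y :: "nat \<Rightarrow> 'a \<Rightarrow> nat" and p :: "nat \<Rightarrow> real"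
  assumes "m \<ge> 1" and indep: "indep_vars (\<lambda>_. count_space UNIV) Y {1..n}"
    and p: "\<And>i j. i \<in> {1..m} \<Longrightarrow> j \<in> {1..n} \<Longrightarrow> prob {\<omega> \<in> space M. Y j \<omega> = i} = p i"
  shows "prob {\<omega> \<in> space M. empirical_nerve m n (\<lambda>j. Y j \<omega>) = full_simplex m} \<ge>
    (\<Sum>xs\<in>full_words {1..m} (n div 2). prod_list (map p xs))\<^sup>2"
proof -
  define h where "h = n div 2"
  \<comment> \<open>For odd \<open>n\<close> the last position lies outside both halves.\<close>
  have h: "2 * h \<le> n"
    by (simp add: h_def)
  define W where "W = full_words {1..m} h"
  define L where "L N \<omega> = map (\<lambda>j. Y j \<omega>) [1..<Suc N]" for N \<omega>
  define E where "E zs = {\<omega> \<in> space M. L (2 * h) \<omega> = zs}" for zs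
  define F where "F = {\<omega> \<in> space M. empirical_nerve m n (\<lambda>j. Y j \<omega>) = full_simplex m}"
  \<comment> \<open>Each pair of half-words is joined into one word of length \<open>2 * h\<close>,
    so that \<open>prob_word\<close> applies to it directly.\<close>
  define S where "S = (\<lambda>(xs, ys). xs @ ys) ` (W \<times> W)"
  have Y: "Y j \<in> measurable M (count_space UNIV)" if "j \<in> {1..n}" for j
    using indep that by (auto simp: indep_vars_def)
  have L: "L N \<in> measurable M (count_space UNIV)" if "N \<le> n" for N
    unfolding L_def by (rule word_measurable) (use Y that in auto)
  have E: "E zs \<in> sets M" for zs
    using measurable_sets[OF L[OF h], of "{zs}"]
    by (simp add: E_def vimage_def Int_def conj_commute)
  \<comment> \<open>The nerve depends only on the word of the first \<open>n\<close> labels, so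
    measurability of \<open>F\<close> reduces to that of \<open>L n\<close>.\<close>
  have "empirical_nerve m n (\<lambda>j. Y j \<omega>) = empirical_nerve m n (\<lambda>j. L n \<omega> ! (j - 1))" for \<omega>
    by (rule empirical_nerve_cong) (auto simp: L_def simp del: upt_Suc)
  then have "F = L n -` {zs. empirical_nerve m n (\<lambda>j. zs ! (j - 1)) = full_simplex m} \<inter> space M"
    by (auto simp: F_def)
  then have F: "F \<in> sets M"
    using measurable_sets[OF L[OF order_refl], of
        "{zs. empirical_nerve m n (\<lambda>j. zs ! (j - 1)) = full_simplex m}"]
    by simp
  have sub: "E zs \<subseteq> F" if zs_S: "zs \<in> S" for zs
  proof
    fix \<omega> assume \<omega>: "\<omega> \<in> E zs"
    obtain xs ys where zs: "zs = xs @ ys" and xs: "xs \<in> W" and ys: "ys \<in> W"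
      using zs_S by (auto simp: S_def)
    have len: "length xs = h" "length ys = h" and set: "set xs = {1..m}" "set ys = {1..m}"
      using xs ys by (auto simp: W_def full_words_def)
    have val: "Y j \<omega> = (xs @ ys) ! (j - 1)" if "j \<in> {1..2*h}" for j
      using \<omega> that unfolding E_def zs L_def map_upt_eq_iff by blast
    have "{1..m} \<subseteq> (\<lambda>j. Y j \<omega>) ` {1..h}"
    proof
      fix i assume "i \<in> {1..m}"
      then obtain k where "k < h" "xs ! k = i"
        using set len by (metis in_set_conv_nth)
      then show "i \<in> (\<lambda>j. Y j \<omega>) ` {1..h}"
        using val[of "Suc k"] len by (intro image_eqI[of _ _ "Suc k"]) (auto simp: nth_append)
    qed
    moreover have "{1..m} \<subseteq> (\<lambda>j. Y j \<omega>) ` {h<..2*h}"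
    proof
      fix i assume "i \<in> {1..m}"
      then obtain k where "k < h" "ys ! k = i"
        using set len by (metis in_set_conv_nth)
      then show "i \<in> (\<lambda>j. Y j \<omega>) ` {h<..2*h}"
        \<comment> \<open>Entry \<open>k\<close> of \<open>ys\<close> is entry \<open>h + k\<close>
          of \<open>xs @ ys\<close>, hence the label with index \<open>Suc (h + k)\<close>.\<close>
        using val[of "Suc (h + k)"] len
        by (intro image_eqI[of _ _ "Suc (h + k)"]) (auto simp: nth_append)
    qed
    ultimately show "\<omega> \<in> F"
      using \<omega> empirical_nerve_full[OF \<open>m \<ge> 1\<close> h] by (simp add: F_def E_def)
  qed
  have fin: "finite S"
    by (simp add: S_def W_def finite_full_words)
  \<comment> \<open>All words in \<open>W\<close> have length \<open>h\<close>, so the place to cut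
    a concatenation is known.\<close>
  have inj: "inj_on (\<lambda>(xs, ys). xs @ ys) (W \<times> W)"
    by (auto simp: inj_on_def W_def full_words_def)
  \<comment> \<open>Here the independence of the halves appears algebraically: the weight of a
    concatenation is the product of the weights.\<close>
  have "(\<Sum>xs\<in>W. prod_list (map p xs))\<^sup>2 =
      (\<Sum>(xs, ys)\<in>W \<times> W. prod_list (map p (xs @ ys)))"
    by (simp add: power2_eq_square sum_product sum.cartesian_product)
  also have "\<dots> = (\<Sum>zs\<in>S. prod_list (map p zs))"
    unfolding S_def sum.reindex[OF inj] by (simp add: case_prod_unfold)
  also have "\<dots> = (\<Sum>zs\<in>S. prob (E zs))"
  proof (rule sum.cong)
    fix zs assume "zs \<in> S"
    then have "length zs = 2 * h" "set zs = {1..m}"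
      by (auto simp: S_def W_def full_words_def)
    then show "prod_list (map p zs) = prob (E zs)"
      unfolding E_def L_def using prob_word[OF indep h, of zs p] p by simp
  qed simp
  \<comment> \<open>Distinct words give disjoint events, as \<open>L (2 * h) \<omega>\<close> has
    only one value.\<close>
  also have "\<dots> = prob (\<Union>zs\<in>S. E zs)"
    by (rule finite_measure_finite_Union[symmetric])
      (use fin E in \<open>auto simp: disjoint_family_on_def E_def\<close>)
  also have "\<dots> \<le> prob F"
    by (rule finite_measure_mono) (use sub F in auto)
  finally show ?thesis
    by (simp add: W_def h_def F_def)
qed

theorem theorem12:
  fixes M :: "'w measure" and Y :: "nat \<Rightarrow> 'w \<Rightarrow> nat"
    and p :: "nat \<Rightarrow> real" and m n :: nat
  assumes "m \<ge> 1" and "n \<ge> 1"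
    and "\<And>i. i \<in> {1..m} \<Longrightarrow> p i > 0"
    and "(\<Sum>i=1..m. p i) = 1"
    and "prob_space M"
    and "prob_space.indep_vars M (\<lambda>_. count_space UNIV) Y {1..n}"
    and "\<And>i j. i \<in> {1..m} \<Longrightarrow> j \<in> {1..n} \<Longrightarrow>
           measure M {\<omega> \<in> space M. Y j \<omega> = i} = p i"
  shows "(\<forall>\<omega>\<in>space M. empirical_nerve m n (\<lambda>j. Y j \<omega>) = full_simplex m \<longleftrightarrow>
            one_skeleton (empirical_nerve m n (\<lambda>j. Y j \<omega>)) = complete_graph_on m)
       \<and> measure M {\<omega> \<in> space M. empirical_nerve m n (\<lambda>j. Y j \<omega>) = full_simplex m}
           \<ge> (\<Sum>x\<in>compositions m (n div 2). multinomial_prob m p x)\<^sup>2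
       \<and> ((\<forall>i\<in>{1..m}. p i = 1 / real m) \<longrightarrow>
            measure M {\<omega> \<in> space M. empirical_nerve m n (\<lambda>j. Y j \<omega>) = full_simplex m}
              \<ge> (fact m / real m ^ (n div 2) * real (Stirling (n div 2) m))\<^sup>2)"
proof (intro conjI ballI impI)
  let ?W = "full_words {1..m} (n div 2)"
  have bound: "measure M {\<omega> \<in> space M. empirical_nerve m n (\<lambda>j. Y j \<omega>) = full_simplex m} \<ge>
      (\<Sum>xs\<in>?W. prod_list (map p xs))\<^sup>2"
    using prob_space.prob_full_simplex_ge assms by blast
  then show "measure M {\<omega> \<in> space M. empirical_nerve m n (\<lambda>j. Y j \<omega>) = full_simplex m} \<ge>
      (\<Sum>x\<in>compositions m (n div 2). multinomial_prob m p x)\<^sup>2"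
    by (simp add: sum_multinomial_prob)
  assume unif: "\<forall>i\<in>{1..m}. p i = 1 / real m"
  \<comment> \<open>With uniform \<open>p\<close> all words in \<open>?W\<close> have equal weight,
    so the sum reduces to their number, given by \<open>card_full_words\<close>.\<close>
  have "prod_list (map p xs) = (1 / real m) ^ (n div 2)" if "xs \<in> ?W" for xs
  proof -
    have "map p xs = map (\<lambda>_. 1 / real m) xs"
      using that unif by (intro map_cong) (auto simp: full_words_def)
    then show ?thesis
      using that by (simp add: full_words_def map_replicate_const)
  qed
  then have "(\<Sum>xs\<in>?W. prod_list (map p xs)) = real (card ?W) * (1 / real m) ^ (n div 2)"
    by simp
  also have "\<dots> = fact m / real m ^ (n div 2) * real (Stirling (n div 2) m)"
    by (simp add: card_full_words power_divide)
  finally show "measure M {\<omega> \<in> space M. empirical_nerve m n (\<lambda>j. Y j \<omega>) = full_simplex m} \<ge>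
      (fact m / real m ^ (n div 2) * real (Stirling (n div 2) m))\<^sup>2"
    using bound by simp
\<comment> \<open>What remains is the equivalence with the complete graph, which holds for each
  outcome separately.\<close>
qed (use assms(1) full_simplex_iff_complete_graph in blast)

end
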